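(* Let $G$ be an infinitesimal generator in $\mathbb{D}$. Then for every $C>0$ the set of points of $\partial\mathbb{D}$ that are regular poles of $G$ of mass $D$ for some $D\ge C$ is finite.
   Context: $\mathbb{D}$ is the open unit disc in $\mathbb{C}$. A semigroup $(\phi_t)_{t\ge0}$ of holomorphic self-maps of $\mathbb{D}$ is a family of holomorphic maps $\phi_t:\mathbb{D}\to\mathbb{D}$ with $\phi_0=\mathrm{id}$, $\phi_{t+s}=\phi_t\circ\phi_s$, and $t\mapsto\phi_t$ continuous for uniform convergence on compacta. Its infinitesimal generator is the unique holomorphic $G:\mathbb{D}\to\mathbb{C}$ with $\partial_t\phi_t(z)=G(\phi_t(z))$ for all $t\ge 0$, $z\in\mathbb D$; an infinitesimal generator in $\mathbb D$ is a $G$ arising this way. A point $x\in\partial\mathbb{D}$ is a regular pole of $G$ of mass $C>0$ if $\angle\liminf_{z\to x}|G(z)(x-z)|=C$ with $C\in(0,+\infty)$, where $\angle\liminf$ is the lower limit as $z\to x$ non-tangentially, i.e. inside Stolz angles $\{z\in\mathbb{D}:|x-z|<R(1-|z|)\}$, $R>1$. (For an infinitesimal generator the non-tangential limit of $G(z)(x-z)$ at $x$ always exists in $\mathbb{C}$.) *)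

theory Defs
  imports "HOL-Complex_Analysis.Complex_Analysis"
begin

abbreviation unit_disc :: "complex set" where
  "unit_disc \<equiv> ball 0 1"

definition holomorphic_semigroup :: "(real \<Rightarrow> complex \<Rightarrow> complex) \<Rightarrow> bool" where
  "holomorphic_semigroup \<phi> \<longleftrightarrow>
     (\<forall>t\<ge>0. \<phi> t holomorphic_on unit_disc \<and> \<phi> t ` unit_disc \<subseteq> unit_disc) \<and>
     (\<forall>z\<in>unit_disc. \<phi> 0 z = z) \<and>
     (\<forall>s\<ge>0. \<forall>t\<ge>0. \<forall>z\<in>unit_disc. \<phi> (t + s) z = \<phi> t (\<phi> s z)) \<and>
     (\<forall>t\<ge>0. \<forall>K. compact K \<and> K \<subseteq> unit_disc \<longrightarrow>
        uniform_limit K \<phi> (\<phi> t) (at t within {0..}))"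

text \<open>At \<open>t = 0\<close> the time derivative is the right derivative. The values of \<open>G\<close> and of
  \<open>\<phi> t\<close> outside the disc, and of \<open>\<phi> t\<close> for negative \<open>t\<close>, are irrelevant.\<close>

definition generator_of :: "(complex \<Rightarrow> complex) \<Rightarrow> (real \<Rightarrow> complex \<Rightarrow> complex) \<Rightarrow> bool" where
  "generator_of G \<phi> \<longleftrightarrow>
     G holomorphic_on unit_disc \<and>
     (\<forall>t\<ge>0. \<forall>z\<in>unit_disc.
        ((\<lambda>s. \<phi> s z) has_vector_derivative G (\<phi> t z)) (at t within {0..}))"

definition infinitesimal_generator :: "(complex \<Rightarrow> complex) \<Rightarrow> bool" where
  "infinitesimal_generator G \<longleftrightarrow> (\<exists>\<phi>. holomorphic_semigroup \<phi> \<and> generator_of G \<phi>)"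

definition stolz_angle :: "complex \<Rightarrow> real \<Rightarrow> complex set" where
  "stolz_angle x R = {z \<in> unit_disc. cmod (x - z) < R * (1 - cmod z)}"

text \<open>The Stolz angles at \<open>x\<close> increase with \<open>R\<close>, so the lower limits along them decrease;
  their infimum is the least cluster value along sequences staying in some Stolz angle.\<close>

definition nontangential_liminf :: "complex \<Rightarrow> (complex \<Rightarrow> real) \<Rightarrow> ereal" where
  "nontangential_liminf x f =
     (INF R\<in>{1<..}. Liminf (at x within stolz_angle x R) (\<lambda>z. ereal (f z)))"

definition regular_pole :: "(complex \<Rightarrow> complex) \<Rightarrow> complex \<Rightarrow> real \<Rightarrow> bool" where
  "regular_pole G x C \<longleftrightarrow>
     x \<in> sphere 0 1 \<and> C > 0 \<and>
     nontangential_liminf x (\<lambda>z. cmod (G z * (x - z))) = ereal C"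

end

theory Submission imports Defs begin

text \<open>Differentiating the Schwarz--Pick inequality for \<open>\<phi> t\<close> at \<open>t = 0\<close> gives
  \<open>G z = a - cnj a * z\<^sup>2 - z * q z\<close> with \<open>a = G 0\<close> and \<open>Re q \<ge> 0\<close>, so only \<open>q\<close> can blow up
  at the boundary. At distinct \<open>x\<^sub>1, \<dots>, x\<^sub>n\<close> on the unit circle, the Schwarz integral formula on
  the circle of radius \<open>\<rho> = (1 + r) / 2\<close> bounds the sum of the \<open>\<bar>q (r x\<^sub>j)\<bar>\<close> by the mean of
  \<open>2 Re q\<close> against the sum of the kernels \<open>\<rho> / \<bar>\<zeta> - r x\<^sub>j\<bar>\<close>. Near any \<open>\<zeta>\<close> at most one of these is
  large, so \<open>(1 - r)\<close> times their sum is at most \<open>2 + o(1)\<close>. If all \<open>x\<^sub>j\<close> are poles of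
  mass at least \<open>C\<close>, letting \<open>r\<close> tend to \<open>1\<close> yields \<open>n * C / 2 \<le> 4 Re (q 0)\<close>.\<close>

section \<open>Schwarz--Pick and the shape of a generator\<close>

text \<open>Schwarz's lemma for \<open>f\<close> followed by the disc automorphism sending
  \<open>f 0\<close> to \<open>0\<close>. The denominator is cleared so that the inequality can be
  squared and differentiated in time without quotients.\<close>

lemma Schwarz_Pick_cross_mult:
  assumes holf: "f holomorphic_on ball 0 1" and img: "f ` ball 0 1 \<subseteq> ball 0 1"
    and z: "z \<in> ball 0 1"
  shows "cmod (f z - f 0) \<le> cmod z * cmod (1 - cnj (f 0) * f z)"
proof -
  define g where "g = Moebius_function 0 (f 0) \<circ> f"
  have f_less: "cmod (f u) < 1" if "cmod u < 1" for u
    using img that by (auto simp: image_subset_iff)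
  have "g holomorphic_on ball 0 1"
    unfolding g_def
    using holomorphic_on_compose_gen[OF holf Moebius_function_holomorphic img] f_less[of 0] by simp
  moreover have "g 0 = 0"
    by (simp add: g_def Moebius_function_eq_zero)
  moreover have "cmod (g u) < 1" if "cmod u < 1" for u
    using that f_less by (simp add: g_def Moebius_function_norm_lt_1)
  ultimately have "cmod (g z) \<le> cmod z"
    using Schwarz_Lemma(1) z by (metis mem_ball_0)
  moreover have "cnj (f 0) * f z \<noteq> 1"
  proof -
    have "cmod (cnj (f 0) * f z) < 1"
      using f_less[of 0] f_less[of z] z mult_strict_mono[of "cmod (f 0)" 1 "cmod (f z)" 1]
      by (simp add: norm_mult)
    then show ?thesis by auto
  qed
  ultimately show ?thesis
    by (simp add: g_def Moebius_function_simple norm_divide divide_simps split: if_splits)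
qed

text \<open>For \<open>t \<ge> 0\<close>, Schwarz--Pick makes the gap \<open>E t\<close>
  nonnegative, and it vanishes at \<open>t = 0\<close>, where \<phi> is the identity. Its right
  derivative there is therefore nonnegative, and it equals \<open>-2\<close> times the real part in
  question.\<close>

lemma infinitesimal_generator_dissipative:
  assumes "infinitesimal_generator G" and z: "z \<in> ball 0 1"
  shows "Re (cnj z * (G z - G 0 + cnj (G 0) * z\<^sup>2)) \<le> 0"
proof -
  obtain \<phi> where sg: "holomorphic_semigroup \<phi>" and gen: "generator_of G \<phi>"
    using assms(1) unfolding infinitesimal_generator_def by blast
  define A where "A t = 1 - cnj (\<phi> t 0) * \<phi> t z" for t
  define B where "B t = \<phi> t z - \<phi> t 0" for t
  \<comment> \<open>With squared norms the gap is a combination of inner products, hence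
    differentiable even where \<open>B\<close> vanishes.\<close>
  define E where "E t = (cmod z)\<^sup>2 * (cmod (A t))\<^sup>2 - (cmod (B t))\<^sup>2" for t
  have init: "\<phi> 0 u = u" if "u \<in> ball 0 1" for u
    using sg that unfolding holomorphic_semigroup_def by blast
  have E_nonneg: "E t \<ge> 0" if "t \<ge> 0" for t
  proof -
    have "cmod (B t) \<le> cmod z * cmod (A t)"
      unfolding A_def B_def using sg that z
      by (intro Schwarz_Pick_cross_mult) (auto simp: holomorphic_semigroup_def)
    then have "(cmod (B t))\<^sup>2 \<le> (cmod z * cmod (A t))\<^sup>2"
      by (intro power_mono) auto
    then show ?thesis
      by (simp add: E_def power_mult_distrib)
  qed
  have A0: "A 0 = 1" and B0: "B 0 = z" and E0: "E 0 = 0"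
    using init[of 0] init[of z] z by (auto simp: A_def B_def E_def)
  have dz: "((\<lambda>t. \<phi> t z) has_vector_derivative G z) (at 0 within {0..})"
    and d0: "((\<lambda>t. \<phi> t 0) has_vector_derivative G 0) (at 0 within {0..})"
    using gen init z unfolding generator_of_def by (force+)
  have dA: "(A has_vector_derivative - (cnj (G 0) * z)) (at 0 within {0..})"
    unfolding A_def
    by (rule derivative_eq_intros dz d0 refl)+ (use init[of 0] init[of z] z in simp)
  have dB: "(B has_vector_derivative (G z - G 0)) (at 0 within {0..})"
    unfolding B_def by (intro derivative_intros dz d0)
  have E_eq: "E = (\<lambda>t. (cmod z)\<^sup>2 * (A t \<bullet> A t) - B t \<bullet> B t)"
    by (simp add: E_def fun_eq_iff dot_square_norm)
  define d where "d = - 2 * Re (cnj z * (G z - G 0 + cnj (G 0) * z\<^sup>2))"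
  have "(E has_real_derivative d) (at 0 within {0..})"
  proof -
    have "(E has_derivative
       (\<lambda>h. (cmod z)\<^sup>2 * (A 0 \<bullet> (h *\<^sub>R - (cnj (G 0) * z)) + (h *\<^sub>R - (cnj (G 0) * z)) \<bullet> A 0)
          - (B 0 \<bullet> (h *\<^sub>R (G z - G 0)) + (h *\<^sub>R (G z - G 0)) \<bullet> B 0))) (at 0 within {0..})"
      unfolding E_eq
      using dA dB unfolding has_vector_derivative_def
      by (intro has_derivative_diff has_derivative_mult_right has_derivative_inner)
    moreover have "(\<lambda>h. (cmod z)\<^sup>2 * (A 0 \<bullet> (h *\<^sub>R - (cnj (G 0) * z)) + (h *\<^sub>R - (cnj (G 0) * z)) \<bullet> A 0)
          - (B 0 \<bullet> (h *\<^sub>R (G z - G 0)) + (h *\<^sub>R (G z - G 0)) \<bullet> B 0)) = (*) d"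
      unfolding A0 B0 d_def cmod_power2
      by (simp add: fun_eq_iff inner_complex_def power2_eq_square algebra_simps)
    ultimately show ?thesis
      by (simp add: has_field_derivative_def)
  qed
  then have "\<not> d < 0"
    using has_real_derivative_neg_dec_right[of E d 0 "{0..}"] E0 E_nonneg
    by (metis (no_types, lifting) add_0 atLeast_iff dense less_le_not_le)
  then show ?thesis
    unfolding d_def by linarith
qed

lemma infinitesimal_generator_decomposition:
  assumes G: "infinitesimal_generator G"
  obtains q where "q holomorphic_on ball 0 1"
    and "\<And>z. z \<in> ball 0 1 \<Longrightarrow> z \<noteq> 0 \<Longrightarrow> Re (q z) \<ge> 0"
    and "\<And>z. G z = G 0 - cnj (G 0) * z\<^sup>2 - z * q z"
proof -
  define h where "h z = - (G z - G 0 + cnj (G 0) * z\<^sup>2)" for z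
  \<comment> \<open>Since \<open>h 0 = 0\<close>, this is \<open>h z / z\<close> with its removable
    singularity filled in, written in the form \<open>pole_lemma\<close> expects.\<close>
  define q where "q z = (if z = 0 then deriv h 0 else (h z - h 0) / (z - 0))" for z
  have "G holomorphic_on ball 0 1"
    using G unfolding infinitesimal_generator_def generator_of_def by blast
  then have "h holomorphic_on ball 0 1"
    unfolding h_def by (intro holomorphic_intros)
  then have "q holomorphic_on ball 0 1"
    unfolding q_def by (rule pole_lemma) simp
  moreover have "Re (q z) \<ge> 0" if "z \<in> ball 0 1" "z \<noteq> 0" for z
  proof -
    have "q z = cnj z * h z / complex_of_real ((cmod z)\<^sup>2)"
      using that(2) by (simp add: q_def h_def complex_norm_square del: of_real_power)
    then have "Re (q z) = Re (cnj z * h z) / (cmod z)\<^sup>2"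
      by (metis Re_divide_of_real)
    moreover have "Re (cnj z * h z) \<ge> 0"
      using infinitesimal_generator_dissipative[OF G that(1)] by (simp add: h_def algebra_simps)
    ultimately show ?thesis by simp
  qed
  moreover have "G z = G 0 - cnj (G 0) * z\<^sup>2 - z * q z" for z
    by (simp add: q_def h_def)
  ultimately show ?thesis
    by (rule that)
qed

section \<open>Cauchy and Schwarz integrals over a circle\<close>

text \<open>Cauchy's formula as a mean over the parameter: on a circle centred at \<open>0\<close>,
  the differential divided by \<open>2 * pi * \<i>\<close> is the point itself times
  \<open>dt\<close>.\<close>

lemma Cauchy_circle_mean:
  assumes "f holomorphic_on cball 0 \<rho>" and "cmod w < \<rho>"
  shows "((\<lambda>t. f (circlepath 0 \<rho> t) * (circlepath 0 \<rho> t / (circlepath 0 \<rho> t - w)))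
           has_integral f w) {0..1}"
proof -
  have "((\<lambda>u. f u / (u - w)) has_contour_integral (2 * of_real pi * \<i> * f w)) (circlepath 0 \<rho>)"
    using assms by (intro Cauchy_integral_circlepath_simple) auto
  then have "((\<lambda>t. (f (circlepath 0 \<rho> t) / (circlepath 0 \<rho> t - w)
      * (2 * pi * \<i> * \<rho> * exp (2 * of_real pi * \<i> * t))) / (2 * of_real pi * \<i>))
      has_integral (2 * of_real pi * \<i> * f w) / (2 * of_real pi * \<i>)) {0..1}"
    unfolding has_contour_integral vector_derivative_circlepath by (rule has_integral_divide)
  moreover have "(f (circlepath 0 \<rho> t) / (circlepath 0 \<rho> t - w)
      * (2 * pi * \<i> * \<rho> * exp (2 * of_real pi * \<i> * t))) / (2 * of_real pi * \<i>)
    = f (circlepath 0 \<rho> t) * (circlepath 0 \<rho> t / (circlepath 0 \<rho> t - w))" for t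
  proof -
    have "complex_of_real (2 * pi) * \<i> * \<rho> * exp (2 * of_real pi * \<i> * t)
        = (2 * of_real pi * \<i>) * circlepath 0 \<rho> t"
      by (simp add: circlepath)
    then show ?thesis by simp
  qed
  moreover have "2 * of_real pi * \<i> * f w / (2 * of_real pi * \<i>) = f w" by simp
  ultimately show ?thesis by (simp only:)
qed

lemma norm_circlepath_0: "\<rho> > 0 \<Longrightarrow> cmod (circlepath 0 \<rho> t) = \<rho>"
  by (simp add: circlepath norm_mult)

text \<open>The conjugate of \<open>f\<close> is reproduced at \<open>0\<close> by the Cauchy kernel at \<open>w\<close>, because on the
  circle that kernel is the conjugate of a function holomorphic inside.\<close>

lemma Schwarz_integral_formula:
  assumes holf: "f holomorphic_on cball 0 \<rho>" and w: "cmod w < \<rho>"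
  shows "((\<lambda>t. of_real (2 * Re (f (circlepath 0 \<rho> t)))
             * (circlepath 0 \<rho> t / (circlepath 0 \<rho> t - w)))
           has_integral f w + cnj (f 0)) {0..1}"
proof -
  have \<rho>: "\<rho> > 0" using w norm_ge_zero[of w] by linarith
  \<comment> \<open>For \<open>cmod u = \<rho>\<close> the added factor is the conjugate of
    \<open>u / (u - w)\<close>, because \<open>u * cnj u = \<rho>\<^sup>2\<close>. If
    \<open>w\<close> is nonzero, its pole is the reflection of \<open>w\<close> in the circle, hence
    outside.\<close>
  define g where "g u = f u * (\<rho>\<^sup>2 / (\<rho>\<^sup>2 - cnj w * u))" for u
  have nz: "complex_of_real (\<rho>\<^sup>2) - cnj w * u \<noteq> 0" if "cmod u \<le> \<rho>" for u
  proof
    assume "complex_of_real (\<rho>\<^sup>2) - cnj w * u = 0"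
    then have "complex_of_real (\<rho>\<^sup>2) = cnj w * u" by simp
    then have "\<rho> * \<rho> = cmod w * cmod u"
      by (metis abs_of_nonneg complex_mod_cnj norm_mult norm_of_real power2_eq_square zero_le_power2)
    moreover have "cmod w * cmod u < \<rho> * \<rho>"
      using w that \<rho> mult_left_mono[OF that norm_ge_zero[of w]] mult_strict_right_mono[OF w \<rho>] by linarith
    ultimately show False by simp
  qed
  have "g holomorphic_on cball 0 \<rho>"
    unfolding g_def using nz by (intro holomorphic_intros holf) auto
  then have "((\<lambda>t. g (circlepath 0 \<rho> t) * (circlepath 0 \<rho> t / (circlepath 0 \<rho> t - 0)))
           has_integral g 0) {0..1}"
    using \<rho> by (intro Cauchy_circle_mean) auto
  then have "((\<lambda>t. cnj (g (circlepath 0 \<rho> t) * (circlepath 0 \<rho> t / (circlepath 0 \<rho> t - 0))))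
           has_integral cnj (g 0)) {0..1}"
    by (subst (asm) has_integral_cnj[symmetric]) (simp only: o_def)
  moreover have kernel: "cnj (g c * (c / (c - 0))) = cnj (f c) * (c / (c - w))" if c: "cmod c = \<rho>" for c
  proof -
    have c0: "c \<noteq> 0" using c \<rho> by auto
    have "complex_of_real \<rho> * \<rho> = c * cnj c"
      using c complex_norm_square[of c] by (simp add: power2_eq_square)
    then have "cnj (g c * (c / (c - 0))) = cnj (f c) * (c * cnj c / (c * cnj c - w * cnj c))"
      using c0 by (simp add: g_def power2_eq_square mult.commute[of "cnj c" c])
    also have "c * cnj c - w * cnj c = (c - w) * cnj c"
      by (simp add: algebra_simps)
    finally show ?thesis
      using c0 by simp
  qed
  moreover have "cnj (g 0) = cnj (f 0)"
    using \<rho> by (simp add: g_def)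
  ultimately have "((\<lambda>t. cnj (f (circlepath 0 \<rho> t))
           * (circlepath 0 \<rho> t / (circlepath 0 \<rho> t - w))) has_integral cnj (f 0)) {0..1}"
    unfolding kernel[OF norm_circlepath_0[OF \<rho>]] by metis
  from has_integral_add[OF Cauchy_circle_mean[OF holf w] this] show ?thesis
    unfolding distrib_right[symmetric] complex_add_cnj .
qed

text \<open>Integrating \<open>2 * Re f\<close> over the circle gives a positive measure of total
  mass \<open>2 * Re (f 0)\<close>, so a pointwise bound on the sum of kernels bounds all the values
  together. The summand \<open>cnj (f 0)\<close> is left over from the Schwarz formula.\<close>

lemma sum_norm_le_of_Re_nonneg:
  assumes holf: "f holomorphic_on cball 0 \<rho>" and \<rho>: "\<rho> > 0"
    and A: "finite A"
    and pos: "\<And>u. cmod u = \<rho> \<Longrightarrow> Re (f u) \<ge> 0"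
    and w: "\<And>x. x \<in> A \<Longrightarrow> cmod (w x) < \<rho>"
    and K: "\<And>u. cmod u = \<rho> \<Longrightarrow> (\<Sum>x\<in>A. \<rho> / cmod (u - w x)) \<le> K"
  shows "(\<Sum>x\<in>A. cmod (f (w x) + cnj (f 0))) \<le> 2 * K * Re (f 0)"
proof -
  let ?c = "circlepath 0 \<rho>"
  define F where "F x = f (w x) + cnj (f 0)" for x
  \<comment> \<open>The factors \<open>cnj (sgn (F x))\<close> rotate each \<open>F x\<close> onto
    its modulus, so that a single integral represents the sum of the norms. Where
    \<open>F x = 0\<close>, \<open>sgn\<close> is \<open>0\<close> and the term is still
    correct.\<close>
  have int: "((\<lambda>t. \<Sum>x\<in>A. cnj (sgn (F x)) * (of_real (2 * Re (f (?c t))) * (?c t / (?c t - w x))))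
      has_integral (\<Sum>x\<in>A. cnj (sgn (F x)) * F x)) {0..1}"
    unfolding F_def using A w
    by (intro has_integral_sum has_integral_mult_right Schwarz_integral_formula holf) auto
  \<comment> \<open>At \<open>w = 0\<close> the kernel is identically \<open>1\<close>, which yields
    the total mass.\<close>
  have "((\<lambda>t. of_real (2 * Re (f (?c t))) * (?c t / (?c t - 0))) has_integral f 0 + cnj (f 0)) {0..1}"
    using \<rho> by (intro Schwarz_integral_formula holf) auto
  then have "((\<lambda>t. Re (of_real (2 * Re (f (?c t))) * (?c t / (?c t - 0)))) has_integral Re (f 0 + cnj (f 0))) {0..1}"
    by (rule has_integral_linear[OF _ bounded_linear_Re, unfolded o_def])
  moreover have "?c t \<noteq> 0" for t
    using norm_circlepath_0[OF \<rho>, of t] \<rho> by auto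
  ultimately have "((\<lambda>t. 2 * Re (f (?c t))) has_integral 2 * Re (f 0)) {0..1}"
    by simp
  then have maj: "((\<lambda>t. K * (2 * Re (f (?c t)))) has_integral K * (2 * Re (f 0))) {0..1}"
    by (rule has_integral_mult_right)
  have "cmod (\<Sum>x\<in>A. cnj (sgn (F x)) * (of_real (2 * Re (f (?c t))) * (?c t / (?c t - w x))))
      \<le> K * (2 * Re (f (?c t)))" for t
  proof -
    have c: "cmod (?c t) = \<rho>" by (rule norm_circlepath_0[OF \<rho>])
    have "cmod (\<Sum>x\<in>A. cnj (sgn (F x)) * (of_real (2 * Re (f (?c t))) * (?c t / (?c t - w x))))
       \<le> (\<Sum>x\<in>A. 2 * Re (f (?c t)) * (\<rho> / cmod (?c t - w x)))"
    proof (rule sum_norm_le)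
      fix x
      have "cmod (sgn (F x)) * (2 * Re (f (?c t)) * (\<rho> / cmod (?c t - w x)))
          \<le> 1 * (2 * Re (f (?c t)) * (\<rho> / cmod (?c t - w x)))"
        using pos[OF c] \<rho> by (intro mult_right_mono) (auto simp: norm_sgn)
      then show "cmod (cnj (sgn (F x)) * (of_real (2 * Re (f (?c t))) * (?c t / (?c t - w x))))
          \<le> 2 * Re (f (?c t)) * (\<rho> / cmod (?c t - w x))"
        using pos[OF c] c by (simp add: norm_mult norm_divide)
    qed
    also have "\<dots> = 2 * Re (f (?c t)) * (\<Sum>x\<in>A. \<rho> / cmod (?c t - w x))"
      by (simp add: sum_distrib_left)
    also have "\<dots> \<le> 2 * Re (f (?c t)) * K"
      using pos[OF c] K[OF c] by (intro mult_left_mono) auto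
    finally show ?thesis by (simp add: mult_ac)
  qed
  then have "cmod (\<Sum>x\<in>A. cnj (sgn (F x)) * F x) \<le> K * (2 * Re (f 0))"
    using has_integral_norm_bound_integral_component[OF int maj, of 1]
    unfolding inner_real_def mult_1_right by blast
  moreover have "cnj (sgn (F x)) * F x = of_real (cmod (F x))" for x
  proof -
    have "cnj (sgn (F x)) * F x = (F x * cnj (F x)) / of_real (cmod (F x))"
      by (simp add: sgn_eq)
    also have "\<dots> = of_real ((cmod (F x))\<^sup>2 / cmod (F x))"
      by (simp only: of_real_divide complex_norm_square)
    finally show ?thesis
      by (simp add: power2_eq_square)
  qed
  ultimately have "cmod (of_real (\<Sum>x\<in>A. cmod (F x))) \<le> K * (2 * Re (f 0))"
    by simp
  then have "(\<Sum>x\<in>A. cmod (F x)) \<le> K * (2 * Re (f 0))"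
    by (subst (asm) norm_of_real) linarith
  then show ?thesis
    by (simp add: F_def mult_ac)
qed

section \<open>Kernel sums over separated points\<close>

text \<open>The points \<open>r * x\<close> are \<delta>\<open>* r\<close> apart, so at most one
  lies within half that distance of \<open>u\<close>. That one is controlled by the gap
  \<rho>\<open>- r\<close> between the circles, every other by the half distance.\<close>

lemma sum_inverse_dist_le:
  fixes A :: "complex set"
  assumes "finite A" "A \<subseteq> sphere 0 1" "\<delta> > 0" "0 < r" "r < \<rho>"
    and sep: "\<And>x y. x \<in> A \<Longrightarrow> y \<in> A \<Longrightarrow> x \<noteq> y \<Longrightarrow> \<delta> \<le> dist x y"
    and u: "cmod u = \<rho>"
  shows "(\<Sum>x\<in>A. 1 / cmod (u - of_real r * x)) \<le> 1 / (\<rho> - r) + real (card A) * (2 / (\<delta> * r))"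
proof -
  define b where "b x = 1 / cmod (u - of_real r * x)" for x
  have near: "b x \<le> 1 / (\<rho> - r)" if "x \<in> A" for x
  proof -
    have "cmod (of_real r * x) = r" using that assms by (auto simp: norm_mult)
    then have "\<rho> - r \<le> cmod (u - of_real r * x)"
      using norm_triangle_ineq2[of u "of_real r * x"] u by simp
    then show ?thesis unfolding b_def using assms by (intro divide_left_mono mult_pos_pos) auto
  qed
  have far: "b x \<le> 2 / (\<delta> * r)" if "\<delta> * r / 2 \<le> cmod (u - of_real r * x)" for x
  proof -
    have "\<delta> * r / 2 > 0" using assms by simp
    then have "b x \<le> 1 / (\<delta> * r / 2)"
      unfolding b_def using that by (intro divide_left_mono mult_pos_pos) auto
    then show ?thesis by simp
  qed
  show ?thesis
  proof (cases "\<exists>x\<in>A. cmod (u - of_real r * x) < \<delta> * r / 2")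
    case True
    then obtain x where x: "x \<in> A" "cmod (u - of_real r * x) < \<delta> * r / 2" by blast
    have "b y \<le> 2 / (\<delta> * r)" if y: "y \<in> A - {x}" for y
    proof (rule far)
      have "\<delta> * r \<le> dist x y * r"
        using sep[of x y] x y assms by (intro mult_right_mono) auto
      also have "\<dots> = cmod (of_real r * x - of_real r * y)"
        using assms by (simp add: dist_norm norm_mult flip: right_diff_distrib)
      also have "\<dots> \<le> cmod (u - of_real r * x) + cmod (u - of_real r * y)"
        using norm_triangle_ineq4[of "u - of_real r * y" "u - of_real r * x"] by simp
      finally show "\<delta> * r / 2 \<le> cmod (u - of_real r * y)" using x by simp
    qed
    then have "sum b (A - {x}) \<le> real (card (A - {x})) * (2 / (\<delta> * r))"
      by (rule sum_bounded_above)
    also have "\<dots> \<le> real (card A) * (2 / (\<delta> * r))"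
      using assms by (intro mult_right_mono) (auto simp: card_Diff1_le)
    finally show ?thesis
      using near[OF x(1)] sum.remove[OF assms(1) x(1), of b] by (simp add: b_def)
  next
    case False
    then have "sum b A \<le> real (card A) * (2 / (\<delta> * r))"
      by (intro sum_bounded_above far) (force simp: not_less)
    moreover have "1 / (\<rho> - r) > 0" using assms by simp
    ultimately show ?thesis unfolding b_def by linarith
  qed
qed

lemma finite_imp_separated:
  fixes A :: "'a::metric_space set"
  assumes "finite A"
  obtains \<delta> where "\<delta> > 0" "\<And>x y. x \<in> A \<Longrightarrow> y \<in> A \<Longrightarrow> x \<noteq> y \<Longrightarrow> \<delta> \<le> dist x y"
proof -
  \<comment> \<open>The inserted \<open>1\<close> keeps the minimum meaningful when \<open>A\<close>
    has at most one point.\<close>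
  define D where "D = insert 1 ((\<lambda>(x, y). dist x y) ` {(x, y) \<in> A \<times> A. x \<noteq> y})"
  have "finite {(x, y) \<in> A \<times> A. x \<noteq> y}"
    by (rule finite_subset[of _ "A \<times> A"]) (use assms in auto)
  then have D: "finite D" "D \<noteq> {}"
    unfolding D_def by auto
  show ?thesis
  proof
    show "Min D > 0"
      using D by (subst Min_gr_iff) (auto simp: D_def)
    show "Min D \<le> dist x y" if "x \<in> A" "y \<in> A" "x \<noteq> y" for x y
      using that D(1) by (intro Min_le) (auto simp: D_def)
  qed
qed

section \<open>Radial growth at poles and the counting bound\<close>

text \<open>The radius to \<open>x\<close> lies in the Stolz angle with \<open>R = 2\<close>,
  because on it the distance to \<open>x\<close> equals the distance to the circle. The lower limit
  in that angle is at least the infimum \<open>D\<close>.\<close>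

lemma regular_pole_eventually_radial:
  assumes "regular_pole G x D" and "C < D"
  shows "eventually (\<lambda>r. C < (1 - r) * cmod (G (of_real r * x))) (at_left 1)"
proof -
  have x: "cmod x = 1"
    and D: "nontangential_liminf x (\<lambda>z. cmod (G z * (x - z))) = ereal D"
    using assms(1) by (auto simp: regular_pole_def)
  have "ereal C < ereal D" using assms(2) by simp
  also have "ereal D \<le> Liminf (at x within stolz_angle x 2) (\<lambda>z. ereal (cmod (G z * (x - z))))"
    unfolding D[symmetric] nontangential_liminf_def by (rule INF_lower) simp
  finally have ev: "eventually (\<lambda>z. ereal C < ereal (cmod (G z * (x - z)))) (at x within stolz_angle x 2)"
    by (rule less_LiminfD)
  have diff: "cmod (x - of_real r * x) = 1 - r" if "r < 1" for r
  proof -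
    have "x - of_real r * x = of_real (1 - r) * x" by (simp add: algebra_simps)
    then show ?thesis using that x by (simp only: norm_mult norm_of_real) simp
  qed
  have range: "eventually (\<lambda>r::real. 0 < r \<and> r < 1) (at_left 1)"
    by (rule eventually_at_leftI[of 0]) auto
  have "filterlim (\<lambda>r. of_real r * x) (at x within stolz_angle x 2) (at_left 1)"
    unfolding filterlim_at
  proof
    show "eventually (\<lambda>r. of_real r * x \<in> stolz_angle x 2 \<and> of_real r * x \<noteq> x) (at_left 1)"
      using range
    proof eventually_elim
      case (elim r)
      then have "cmod (x - of_real r * x) = 1 - r" "cmod (of_real r * x) = r"
        using diff x by (auto simp: norm_mult)
      then show ?case
        using elim by (auto simp: stolz_angle_def)
    qed
    have "((\<lambda>r. of_real r * x) \<longlongrightarrow> of_real 1 * x) (at_left 1)"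
      by (intro tendsto_intros)
    then show "((\<lambda>r. of_real r * x) \<longlongrightarrow> x) (at_left 1)" by simp
  qed
  from eventually_compose_filterlim[OF ev this] range show ?thesis
    by eventually_elim (metis diff less_ereal.simps(1) mult.commute norm_mult)
qed

theorem corollary3p6:
  fixes G :: "complex \<Rightarrow> complex" and C :: real
  assumes "infinitesimal_generator G"
    and "C > 0"
  shows "finite {x \<in> sphere 0 1. \<exists>D\<ge>C. regular_pole G x D}"
proof -
  obtain q where holq: "q holomorphic_on ball 0 1"
    and Re_q: "\<And>z. z \<in> ball 0 1 \<Longrightarrow> z \<noteq> 0 \<Longrightarrow> Re (q z) \<ge> 0"
    and G_eq: "\<And>z. G z = G 0 - cnj (G 0) * z\<^sup>2 - z * q z"
    using infinitesimal_generator_decomposition[OF assms(1)] by blast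
  \<comment> \<open>The right-hand side does not depend on \<open>A\<close>. Halving
    \<open>C\<close> provides the strict inequality needed at poles of mass exactly
    \<open>C\<close>.\<close>
  have card_le: "real (card A) * (C / 2) \<le> 4 * Re (q 0)"
    if A: "finite A" "A \<subseteq> {x \<in> sphere 0 1. \<exists>D\<ge>C. regular_pole G x D}" for A
  proof -
    define n where "n = real (card A)"
    obtain \<delta> where \<delta>: "\<delta> > 0" "\<And>x y. x \<in> A \<Longrightarrow> y \<in> A \<Longrightarrow> x \<noteq> y \<Longrightarrow> \<delta> \<le> dist x y"
      using finite_imp_separated[OF A(1)] by blast
    define bound where "bound r = n * ((1 - r) * (2 * cmod (G 0) + cmod (q 0)))
      + 2 * (2 + (1 - r) * (n * (2 / (\<delta> * r)))) * Re (q 0)" for r :: real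
    have "\<forall>x\<in>A. eventually (\<lambda>r. C / 2 < (1 - r) * cmod (G (of_real r * x))) (at_left 1)"
    proof
      fix x assume "x \<in> A"
      then obtain D where "D \<ge> C" "regular_pole G x D" using A(2) by auto
      then show "eventually (\<lambda>r. C / 2 < (1 - r) * cmod (G (of_real r * x))) (at_left 1)"
        using assms(2) by (intro regular_pole_eventually_radial) auto
    qed
    then have "eventually (\<lambda>r. \<forall>x\<in>A. C / 2 < (1 - r) * cmod (G (of_real r * x))) (at_left 1)"
      using A(1) by (simp add: eventually_ball_finite)
    moreover have "eventually (\<lambda>r::real. 0 < r \<and> r < 1) (at_left 1)"
      by (rule eventually_at_leftI[of 0]) auto
    ultimately have "eventually (\<lambda>r. n * (C / 2) \<le> bound r) (at_left 1)"
    proof eventually_elim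
      case (elim r)
      then have r: "0 < r" "r < 1" by auto
      \<comment> \<open>\<open>q\<close> is known to be holomorphic only in the open disc, so the
        circle must stay inside it. The midpoint keeps \<open>(1 - r) / (\<rho> - r)\<close> equal
        to \<open>2\<close>.\<close>
      define \<rho> where "\<rho> = (1 + r) / 2"
      define K where "K = 1 / (\<rho> - r) + n * (2 / (\<delta> * r))"
      have \<rho>: "0 < \<rho>" "\<rho> < 1" "r < \<rho>" using r by (auto simp: \<rho>_def)
      have norm_A: "cmod (of_real r * x) = r" if "x \<in> A" for x
        using that A(2) r by (auto simp: norm_mult)
      have sum_q: "(\<Sum>x\<in>A. cmod (q (of_real r * x) + cnj (q 0))) \<le> 2 * K * Re (q 0)"
      proof (rule sum_norm_le_of_Re_nonneg)
        show "q holomorphic_on cball 0 \<rho>"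
          using \<rho> by (intro holomorphic_on_subset[OF holq]) auto
        show "Re (q u) \<ge> 0" if "cmod u = \<rho>" for u
          using that \<rho> by (intro Re_q) auto
        show "(\<Sum>x\<in>A. \<rho> / cmod (u - of_real r * x)) \<le> K" if u: "cmod u = \<rho>" for u
        proof -
          have "(\<Sum>x\<in>A. \<rho> / cmod (u - of_real r * x)) \<le> (\<Sum>x\<in>A. 1 / cmod (u - of_real r * x))"
            using \<rho> by (intro sum_mono divide_right_mono) auto
          also have "\<dots> \<le> K"
            unfolding K_def n_def using A \<delta> r \<rho> u by (intro sum_inverse_dist_le) auto
          finally show ?thesis .
        qed
      qed (use A \<rho> norm_A in auto)
      \<comment> \<open>Besides the growth of \<open>q\<close>, the decomposition contributes at
        most \<open>2 * cmod (G 0)\<close>; removing the Schwarz constant costs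
        \<open>cmod (q 0)\<close>. Both disappear after multiplication by
        \<open>1 - r\<close>.\<close>
      have G_le: "cmod (G (of_real r * x)) \<le> 2 * cmod (G 0) + cmod (q 0) + cmod (q (of_real r * x) + cnj (q 0))"
        if "x \<in> A" for x
      proof -
        let ?z = "of_real r * x"
        have z: "cmod ?z = r" using norm_A[OF that] .
        have "cmod (G ?z) \<le> cmod (G 0) + cmod (cnj (G 0) * ?z\<^sup>2) + cmod (?z * q ?z)"
          by (subst G_eq) (meson norm_triangle_ineq4 order_trans add_right_mono)
        also have "cmod (cnj (G 0) * ?z\<^sup>2) \<le> cmod (G 0)"
          unfolding norm_mult[of "cnj (G 0)"] norm_power complex_mod_cnj z using r
          by (intro mult_left_le) (auto simp: power_le_one)
        also have "cmod (?z * q ?z) \<le> cmod (q ?z)"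
          unfolding norm_mult[of ?z] z using r by (intro mult_left_le_one_le) auto
        also have "cmod (q ?z) \<le> cmod (q ?z + cnj (q 0)) + cmod (q 0)"
          using norm_triangle_ineq4[of "q ?z + cnj (q 0)" "cnj (q 0)"] by simp
        finally show ?thesis by simp
      qed
      have "n * (C / 2) \<le> (\<Sum>x\<in>A. (1 - r) * cmod (G (of_real r * x)))"
        unfolding n_def using elim by (intro sum_bounded_below) auto
      also have "\<dots> \<le> (\<Sum>x\<in>A. (1 - r) * (2 * cmod (G 0) + cmod (q 0)
          + cmod (q (of_real r * x) + cnj (q 0))))"
        using G_le r by (intro sum_mono mult_left_mono) auto
      also have "\<dots> = n * ((1 - r) * (2 * cmod (G 0) + cmod (q 0)))
          + (1 - r) * (\<Sum>x\<in>A. cmod (q (of_real r * x) + cnj (q 0)))"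
        by (simp add: n_def distrib_left sum.distrib sum_distrib_left)
      also have "\<dots> \<le> n * ((1 - r) * (2 * cmod (G 0) + cmod (q 0))) + (1 - r) * (2 * K * Re (q 0))"
        using sum_q r by (intro add_left_mono mult_left_mono) auto
      also have "(1 - r) * K = 2 + (1 - r) * (n * (2 / (\<delta> * r)))"
      proof -
        have "(1 - r) * (1 / (\<rho> - r)) = 2" using r by (simp add: \<rho>_def field_simps)
        then show ?thesis by (simp add: K_def distrib_left)
      qed
      then have "(1 - r) * (2 * K * Re (q 0)) = 2 * (2 + (1 - r) * (n * (2 / (\<delta> * r)))) * Re (q 0)"
        by (metis mult.assoc mult.left_commute)
      finally show ?case by (simp add: bound_def)
    qed
    \<comment> \<open>As \<open>r\<close> tends to \<open>1\<close> with \<open>A\<close> and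
      \<delta> fixed, only the contribution of the single nearby kernel survives:
      \<open>2 * 2 * Re (q 0)\<close>.\<close>
    moreover have "(bound \<longlongrightarrow> n * ((1 - 1) * (2 * cmod (G 0) + cmod (q 0)))
      + 2 * (2 + (1 - 1) * (n * (2 / (\<delta> * 1)))) * Re (q 0)) (at_left 1)"
      unfolding bound_def using \<delta>(1) by (intro tendsto_intros) auto
    ultimately have "n * (C / 2) \<le> n * ((1 - 1) * (2 * cmod (G 0) + cmod (q 0)))
      + 2 * (2 + (1 - 1) * (n * (2 / (\<delta> * 1)))) * Re (q 0)"
      by (intro tendsto_lowerbound) auto
    then show ?thesis by (simp add: n_def)
  qed
  have "card A \<le> nat \<lfloor>4 * Re (q 0) / (C / 2)\<rfloor>"
    if "A \<subseteq> {x \<in> sphere 0 1. \<exists>D\<ge>C. regular_pole G x D}" "finite A" for A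
  proof -
    have "real (card A) \<le> 4 * Re (q 0) / (C / 2)"
      using card_le[OF that(2,1)] assms(2) by (simp add: field_simps)
    then show ?thesis by (simp add: le_nat_floor)
  qed
  \<comment> \<open>An infinite set would have finite subsets of every cardinality, contradicting
    the uniform bound.\<close>
  then show ?thesis
    using finite_if_finite_subsets_card_bdd by blast
qed

end
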